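(* Let $G_1$ and $G_2$ be two simple strongly connected digraphs, each with $n\ge 4$ vertices and $m$ arcs, and let $\alpha\in[\frac{1}{\sqrt{2}},1)$. If $\Delta^+(G_1)\ge 2\alpha(1-\alpha)(m-n+1)+2\alpha$ and $\Delta^+(G_1)>\Delta^+(G_2)$, then $\lambda_\alpha(G_1)>\lambda_\alpha(G_2)$.
   Context: All digraphs are simple (no loops, no multiple arcs). A digraph is strongly connected if for every ordered pair of vertices $v_i,v_j$ there is a directed path from $v_i$ to $v_j$. For a digraph $G$ with vertex set $\{v_1,\dots,v_n\}$, the outdegree $d_i^+$ of $v_i$ is the number of arcs with tail $v_i$, and $\Delta^+(G)$ is the maximum outdegree. $A(G)=(a_{ij})$ is the adjacency matrix ($a_{ij}=1$ if $(v_i,v_j)$ is an arc, $0$ otherwise), $D(G)=\mathrm{diag}(d_1^+,\dots,d_n^+)$, and for $\alpha\in[0,1]$, $A_\alpha(G)=\alpha D(G)+(1-\alpha)A(G)$. The $A_\alpha$ spectral radius $\lambda_\alpha(G)$ is the eigenvalue of $A_\alpha(G)$ of largest modulus (for strongly connected $G$ and $\alpha\in[0,1)$ this is the Perron root of the nonnegative irreducible matrix $A_\alpha(G)$). *)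

theory Defs
  imports
    "Graph_Theory.Digraph_Component"
    "Jordan_Normal_Form.Spectral_Radius"
begin

text \<open>
  The locale \<^locale>\<open>digraph\<close> provides finite digraphs without loops and multiple arcs. The list
  \<open>vs\<close> below is an enumeration \<open>v\<^sub>1, \<dots>, v\<^sub>n\<close> of the vertices of the digraph, that is,
  \<open>distinct vs\<close> and \<open>set vs = verts G\<close>; matrix indices start at 0.
\<close>

definition max_out_degree :: "('a, 'b) pre_digraph \<Rightarrow> nat" where
  "max_out_degree G = Max (out_degree G ` verts G)"

definition adjacency_mat :: "('a, 'b) pre_digraph \<Rightarrow> 'a list \<Rightarrow> real mat" where
  "adjacency_mat G vs = mat (length vs) (length vs)
     (\<lambda>(i, j). if (vs ! i, vs ! j) \<in> arcs_ends G then 1 else 0)"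

definition out_degree_mat :: "('a, 'b) pre_digraph \<Rightarrow> 'a list \<Rightarrow> real mat" where
  "out_degree_mat G vs = mat (length vs) (length vs)
     (\<lambda>(i, j). if i = j then real (out_degree G (vs ! i)) else 0)"

definition A_alpha_mat :: "real \<Rightarrow> ('a, 'b) pre_digraph \<Rightarrow> 'a list \<Rightarrow> real mat" where
  "A_alpha_mat \<alpha> G vs = \<alpha> \<cdot>\<^sub>m out_degree_mat G vs + (1 - \<alpha>) \<cdot>\<^sub>m adjacency_mat G vs"

text \<open>
  \<^const>\<open>spectral_radius\<close> is the largest modulus of a complex eigenvalue. For the nonnegative matrix
  at hand it is itself an eigenvalue (the Perron root), and it does not depend on the enumeration.
\<close>

definition A_alpha_spectral_radius :: "real \<Rightarrow> ('a, 'b) pre_digraph \<Rightarrow> 'a list \<Rightarrow> real" where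
  "A_alpha_spectral_radius \<alpha> G vs =
     spectral_radius (map_mat complex_of_real (A_alpha_mat \<alpha> G vs))"

end

theory Submission
  imports Defs
begin

text \<open>
  A nonnegative matrix has spectral radius at least each of its diagonal entries, so
  \<open>\<lambda>\<^sub>\<alpha>(G1) \<ge> \<alpha> \<Delta>\<close> with \<open>\<Delta> = \<Delta>\<^sup>+(G1)\<close>. For \<open>G2\<close>, weigh the coordinates by the outdegrees: the weighted
  row sum at a vertex of outdegree \<open>d\<close> is at most \<open>\<alpha> d + (1 - \<alpha>) (m - n + 1) / d\<close>, because all
  vertices that are not out-neighbours still have outdegree at least 1. Since \<open>2 \<alpha>\<^sup>2 \<ge> 1\<close>, the
  degree hypothesis gives \<open>(1 - \<alpha>) (m - n + 1) \<le> \<alpha> \<Delta> - 1\<close>, and then the row sum is below \<open>\<alpha> \<Delta>\<close>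
  because \<open>\<alpha> d\<^sup>2 - \<alpha> \<Delta> d + \<alpha> \<Delta> - 1 = \<alpha> (d - 1) (d - (\<Delta> - 1)) - (1 - \<alpha>) < 0\<close> for
  \<open>1 \<le> d \<le> \<Delta> - 1\<close>.
\<close>

section \<open>Bounds for the spectral radius\<close>

text \<open>Conjugating by the diagonal matrix of the weights turns this into the usual row-sum
  bound. Concretely, for an eigenvector \<open>x\<close> of an eigenvalue of largest modulus, the
  eigenvalue equation is read at an index \<open>i\<close> where \<open>norm (x $ i) / w i\<close>
  is maximal.\<close>

lemma spectral_radius_less_weighted_row_sum:
  fixes A :: "complex mat" and w :: "nat \<Rightarrow> real"
  assumes A: "A \<in> carrier_mat n n" and n: "n > 0"
    and w: "\<And>i. i < n \<Longrightarrow> w i > 0"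
    and row: "\<And>i. i < n \<Longrightarrow> (\<Sum>j<n. norm (A $$ (i, j)) * w j) < r * w i"
  shows "spectral_radius A < r"
proof -
  obtain ev where ev: "eigenvalue A ev" "spectral_radius A = norm ev"
    using spectral_radius_mem_max(1)[OF A n] by (auto simp: spectrum_def)
  then obtain x where x: "x \<in> carrier_vec n" "x \<noteq> 0\<^sub>v n" "A *\<^sub>v x = ev \<cdot>\<^sub>v x"
    using A unfolding eigenvalue_def eigenvector_def by auto
  define q where "q i = norm (x $ i) / w i" for i
  obtain i where i: "i < n" "\<And>j. j < n \<Longrightarrow> q j \<le> q i"
  proof -
    have "finite (q ` {..<n})" "q ` {..<n} \<noteq> {}" using n by auto
    from Max_in[OF this] obtain i where "i < n" "Max (q ` {..<n}) = q i" by auto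
    with Max_ge[of "q ` {..<n}"] that show ?thesis
      by (metis finite_imageI finite_lessThan imageI lessThan_iff)
  qed
  have qw: "norm (x $ j) = q j * w j" if "j < n" for j
    using w[OF that] by (simp add: q_def)
  \<comment> \<open>A nonzero coordinate forces the maximal ratio to be positive, so multiplying by
    \<open>q i\<close> keeps the strict row bound and the factor can be cancelled at the
    end.\<close>
  obtain k where k: "k < n" "x $ k \<noteq> 0"
    using x(1,2) by (metis carrier_vecD eq_vecI index_zero_vec)
  have "0 < q k" using w[OF k(1)] k(2) by (simp add: q_def)
  with i(2)[OF k(1)] have qi: "q i > 0" by linarith
  have "ev * x $ i = (A *\<^sub>v x) $ i" using x i by simp
  also have "\<dots> = (\<Sum>j<n. A $$ (i, j) * x $ j)"
    using A x(1) i(1) by (simp add: scalar_prod_def lessThan_atLeast0)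
  finally have "norm ev * norm (x $ i) = norm (\<Sum>j<n. A $$ (i, j) * x $ j)"
    by (metis norm_mult)
  also have "\<dots> \<le> (\<Sum>j<n. norm (A $$ (i, j)) * norm (x $ j))"
    by (rule order_trans[OF norm_sum]) (simp add: norm_mult)
  also have "\<dots> \<le> (\<Sum>j<n. norm (A $$ (i, j)) * (q i * w j))"
  proof (intro sum_mono mult_left_mono)
    fix j assume "j \<in> {..<n}"
    then show "norm (x $ j) \<le> q i * w j"
      using qw i(2) w by (simp add: mult_right_mono less_imp_le)
  qed simp
  also have "\<dots> = q i * (\<Sum>j<n. norm (A $$ (i, j)) * w j)"
    by (simp add: sum_distrib_left algebra_simps)
  also have "\<dots> < q i * (r * w i)"
    using row[OF i(1)] qi by simp
  finally have "norm ev * (q i * w i) < r * (q i * w i)"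
    using qw[OF i(1)] by (simp add: algebra_simps)
  then show ?thesis
    using ev(2) qi w[OF i(1)] by simp
qed

lemma pow_mat_nonneg:
  fixes A :: "real mat"
  assumes A: "A \<in> carrier_mat n n"
    and nonneg: "\<And>i j. i < n \<Longrightarrow> j < n \<Longrightarrow> A $$ (i, j) \<ge> 0"
    and "i < n" "j < n"
  shows "(A ^\<^sub>m k) $$ (i, j) \<ge> 0"
  using assms(3,4)
proof (induction k arbitrary: i j)
  case 0
  then show ?case using A by simp
next
  case (Suc k)
  have "(A ^\<^sub>m Suc k) $$ (i, j) = (\<Sum>l<n. (A ^\<^sub>m k) $$ (i, l) * A $$ (l, j))"
    using A Suc.prems by (simp add: scalar_prod_def lessThan_atLeast0)
  also have "\<dots> \<ge> 0"
    using Suc nonneg by (intro sum_nonneg mult_nonneg_nonneg) auto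
  finally show ?case .
qed

text \<open>The left side is the weight of the closed walk of length \<open>k\<close> that stays at
  \<open>i\<close>; all other closed walks at \<open>i\<close> have nonnegative weight.\<close>

lemma pow_mat_diagonal_ge:
  fixes A :: "real mat"
  assumes A: "A \<in> carrier_mat n n"
    and nonneg: "\<And>i j. i < n \<Longrightarrow> j < n \<Longrightarrow> A $$ (i, j) \<ge> 0"
    and i: "i < n"
  shows "(A $$ (i, i)) ^ k \<le> (A ^\<^sub>m k) $$ (i, i)"
proof (induction k)
  case 0
  then show ?case using A i by simp
next
  case (Suc k)
  have "(A $$ (i, i)) ^ Suc k \<le> (A ^\<^sub>m k) $$ (i, i) * A $$ (i, i)"
    using Suc nonneg[OF i i] by (simp add: mult.commute mult_left_mono)
  also have "\<dots> \<le> (\<Sum>l<n. (A ^\<^sub>m k) $$ (i, l) * A $$ (l, i))"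
    using i by (intro member_le_sum[of i "{..<n}" "\<lambda>l. (A ^\<^sub>m k) $$ (i, l) * A $$ (l, i)"])
      (auto intro!: mult_nonneg_nonneg nonneg pow_mat_nonneg[OF A nonneg])
  also have "\<dots> = (A ^\<^sub>m Suc k) $$ (i, i)"
    using A i by (simp add: scalar_prod_def lessThan_atLeast0)
  finally show ?case .
qed

text \<open>Normalises a matrix so that boundedness of powers for spectral radius below 1 applies:
  an eigenvalue \<open>ev\<close> of the scaled matrix gives the eigenvalue \<open>c * ev\<close> of
  \<open>A\<close>.\<close>

lemma spectral_radius_smult_less_1:
  fixes A :: "complex mat"
  assumes A: "A \<in> carrier_mat n n" and n: "n > 0"
    and c: "spectral_radius A < c" "c > 0"
  shows "spectral_radius (complex_of_real (1 / c) \<cdot>\<^sub>m A) < 1"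
proof -
  let ?B = "complex_of_real (1 / c) \<cdot>\<^sub>m A"
  have B: "?B \<in> carrier_mat n n" using A by simp
  obtain ev where ev: "eigenvalue ?B ev" "spectral_radius ?B = norm ev"
    using spectral_radius_mem_max(1)[OF B n] by (auto simp: spectrum_def)
  then obtain x where x: "x \<in> carrier_vec n" "x \<noteq> 0\<^sub>v n" "?B *\<^sub>v x = ev \<cdot>\<^sub>v x"
    using A unfolding eigenvalue_def eigenvector_def by auto
  have "A *\<^sub>v x = complex_of_real c \<cdot>\<^sub>v (?B *\<^sub>v x)"
    using A x(1) c(2) by (intro eq_vecI) auto
  also have "\<dots> = (complex_of_real c * ev) \<cdot>\<^sub>v x"
    unfolding x(3) by (simp add: smult_smult_assoc)
  finally have "eigenvalue A (complex_of_real c * ev)"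
    using A x unfolding eigenvalue_def eigenvector_def by auto
  then have "norm (complex_of_real c * ev) \<le> spectral_radius A"
    using spectral_radius_mem_max(2)[OF A n] by (auto simp: spectrum_def)
  then have "c * norm ev \<le> spectral_radius A" using c(2) by (simp add: norm_mult)
  with c have "c * norm ev < c * 1" by linarith
  with c(2) ev(2) show ?thesis by simp
qed

text \<open>
  If the spectral radius were smaller, then after rescaling the powers of the matrix would be bounded
  while their diagonal entries grow geometrically.
\<close>

lemma spectral_radius_ge_diagonal:
  fixes A :: "real mat"
  assumes A: "A \<in> carrier_mat n n"
    and nonneg: "\<And>i j. i < n \<Longrightarrow> j < n \<Longrightarrow> A $$ (i, j) \<ge> 0"
    and i: "i < n"
  shows "A $$ (i, i) \<le> spectral_radius (map_mat complex_of_real A)"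
proof (rule ccontr)
  let ?A = "map_mat complex_of_real A"
  assume "\<not> ?thesis"
  \<comment> \<open>Division by such a \<open>c\<close> brings the spectral radius below 1 but
    leaves the diagonal entry above 1.\<close>
  then obtain c where c: "spectral_radius ?A < c" "c < A $$ (i, i)"
    by (meson dense not_le)
  have A': "?A \<in> carrier_mat n n" and n: "n > 0" using A i by auto
  have "spectral_radius ?A \<ge> 0"
    using spectral_radius_mem_max(1)[OF A' n] by auto
  with c have c0: "c > 0" by linarith
  define B where "B = (1 / c) \<cdot>\<^sub>m A"
  have B: "B \<in> carrier_mat n n" using A by (simp add: B_def)
  have Bnn: "B $$ (k, l) \<ge> 0" if "k < n" "l < n" for k l
    using that A nonneg c0 by (simp add: B_def)
  have B': "map_mat complex_of_real B = complex_of_real (1 / c) \<cdot>\<^sub>m ?A"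
    by (intro eq_matI) (auto simp: B_def)
  have "map_mat complex_of_real B \<in> carrier_mat n n" using B by simp
  moreover have "spectral_radius (map_mat complex_of_real B) < 1"
    unfolding B' by (rule spectral_radius_smult_less_1[OF A' n c(1) c0])
  ultimately obtain b where b: "\<And>k. norm_bound (map_mat complex_of_real B ^\<^sub>m k) b"
    using spectral_radius_jnf_norm_bound_less_1_upper_triangular by blast
  have "B $$ (i, i) > 1" using A i c(2) c0 by (simp add: B_def)
  then obtain k where k: "b < (B $$ (i, i)) ^ k" using real_arch_pow by blast
  have "norm_bound (map_mat complex_of_real (B ^\<^sub>m k)) b"
    using b[of k] of_real_hom.mat_hom_pow[OF B, where 'a = complex] by metis
  then have "\<bar>(B ^\<^sub>m k) $$ (i, i)\<bar> \<le> b"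
    using B i by (auto simp: norm_bound_def)
  with pow_mat_diagonal_ge[OF B Bnn i, of k] k show False by linarith
qed

section \<open>Outdegrees\<close>

lemma (in wf_digraph) out_degree_pos:
  assumes "strongly_connected G" "finite (arcs G)" "u \<in> verts G" "v \<in> verts G" "u \<noteq> v"
  shows "out_degree G u > 0"
proof -
  have "u \<rightarrow>\<^sup>* v" using assms by auto
  then obtain w where "u \<rightarrow> w"
    using assms(5) by (cases rule: converse_reachable_cases) auto
  then obtain e where "e \<in> out_arcs G u" by (auto simp: out_arcs_def)
  moreover have "finite (out_arcs G u)" using assms(2) by (simp add: out_arcs_def)
  ultimately show ?thesis by (auto simp: out_degree_def card_gt_0_iff)
qed

lemma (in fin_digraph) sum_out_degree: "(\<Sum>v\<in>verts G. out_degree G v) = card (arcs G)"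
proof -
  have "arcs G = (\<Union>v\<in>verts G. out_arcs G v)"
    by (auto simp: out_arcs_def)
  also have "card \<dots> = (\<Sum>v\<in>verts G. card (out_arcs G v))"
    by (intro card_UN_disjoint) (auto simp: out_arcs_def)
  finally show ?thesis by (simp add: out_degree_def)
qed

lemma (in digraph) card_out_neighbours: "card {v. u \<rightarrow> v} = out_degree G u"
proof -
  have "{v. u \<rightarrow> v} = head G ` out_arcs G u"
    by (auto simp: out_arcs_def arcs_ends_conv image_iff)
  moreover have "inj_on (head G) (out_arcs G u)"
    by (auto simp: inj_on_def out_arcs_def arc_to_ends_def intro: no_multi_arcs)
  ultimately show ?thesis by (simp add: card_image out_degree_def)
qed

text \<open>Of the m arcs, d leave \<open>u\<close> (its outdegree) and at least n - 1 - d leave the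
  vertices outside \<open>u\<close> and its out-neighbours. So at most m - n + 1 remain for the
  out-neighbours: d cancels. The additive form avoids truncated subtraction.\<close>

lemma (in digraph) sum_out_degree_out_neighbours:
  assumes pos: "\<And>v. v \<in> verts G \<Longrightarrow> out_degree G v > 0" and u: "u \<in> verts G"
  shows "(\<Sum>v | u \<rightarrow> v. out_degree G v) + card (verts G) \<le> card (arcs G) + 1"
proof -
  let ?N = "{v. u \<rightarrow> v}"
  let ?R = "verts G - insert u ?N"
  have N: "?N \<subseteq> verts G" by auto
  then have finN: "finite ?N" by (rule finite_subset) simp
  have uN: "u \<notin> ?N" using no_loops by (auto simp: arcs_ends_conv)
  have V: "verts G = insert u ?N \<union> ?R" using N u by auto
  have "card (verts G) = card (insert u ?N) + card ?R"
    by (subst V, rule card_Un_disjoint) (use finN in auto)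
  then have card: "card (verts G) = 1 + out_degree G u + card ?R"
    using finN uN card_out_neighbours by simp
  have "card (arcs G) = (\<Sum>v\<in>insert u ?N. out_degree G v) + (\<Sum>v\<in>?R. out_degree G v)"
    unfolding sum_out_degree[symmetric]
    by (subst V, rule sum.union_disjoint) (use finN in auto)
  moreover have "(\<Sum>v\<in>?R. out_degree G v) \<ge> card ?R"
    using sum_mono[of ?R "\<lambda>_. 1::nat" "out_degree G"] pos by (auto simp: Suc_le_eq)
  ultimately show ?thesis using card finN uN by simp
qed

section \<open>The \<open>A\<^sub>\<alpha>\<close> matrix\<close>

lemma A_alpha_mat_carrier: "A_alpha_mat \<alpha> G vs \<in> carrier_mat (length vs) (length vs)"
  by (simp add: A_alpha_mat_def out_degree_mat_def adjacency_mat_def)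

lemma A_alpha_mat_index:
  assumes "i < length vs" "j < length vs"
  shows "A_alpha_mat \<alpha> G vs $$ (i, j) =
    (if i = j then \<alpha> * out_degree G (vs ! i) else 0) +
    (if vs ! i \<rightarrow>\<^bsub>G\<^esub> vs ! j then 1 - \<alpha> else 0)"
  using assms by (simp add: A_alpha_mat_def out_degree_mat_def adjacency_mat_def)

lemma (in digraph) A_alpha_spectral_radius_ge:
  fixes \<alpha> :: real
  assumes vs: "set vs = verts G" "verts G \<noteq> {}" and \<alpha>: "0 \<le> \<alpha>" "\<alpha> \<le> 1"
  shows "\<alpha> * max_out_degree G \<le> A_alpha_spectral_radius \<alpha> G vs"
proof -
  have "max_out_degree G \<in> out_degree G ` verts G"
    unfolding max_out_degree_def using vs(2) by (intro Max_in) auto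
  then obtain i where i: "i < length vs" "max_out_degree G = out_degree G (vs ! i)"
    unfolding vs(1)[symmetric] by (auto simp: in_set_conv_nth)
  have "\<alpha> * max_out_degree G = A_alpha_mat \<alpha> G vs $$ (i, i)"
    using i by (auto simp: A_alpha_mat_index arcs_ends_conv dest: no_loops)
  also have "\<dots> \<le> A_alpha_spectral_radius \<alpha> G vs"
    unfolding A_alpha_spectral_radius_def
    by (rule spectral_radius_ge_diagonal[OF A_alpha_mat_carrier])
      (use \<alpha> i in \<open>auto simp: A_alpha_mat_index\<close>)
  finally show ?thesis .
qed

lemma (in digraph) A_alpha_weighted_row_sum:
  fixes \<alpha> :: real and w :: "'a \<Rightarrow> real"
  assumes vs: "distinct vs" "set vs = verts G" and i: "i < length vs" and \<alpha>: "0 \<le> \<alpha>" "\<alpha> \<le> 1"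
  shows "(\<Sum>j<length vs. norm (map_mat complex_of_real (A_alpha_mat \<alpha> G vs) $$ (i, j)) * w (vs ! j))
    = \<alpha> * out_degree G (vs ! i) * w (vs ! i) + (1 - \<alpha>) * (\<Sum>v | vs ! i \<rightarrow> v. w v)"
proof -
  let ?u = "vs ! i" and ?f = "\<lambda>v. (if vs ! i \<rightarrow> v then 1 - \<alpha> else 0) * w v"
  \<comment> \<open>Distinctness of \<open>vs\<close> lets the sum over indices become a sum over
    vertices.\<close>
  have nth: "bij_betw ((!) vs) {..<length vs} (verts G)"
    using bij_betw_nth[OF vs(1) refl refl] vs(2) by simp
  have "(\<Sum>j<length vs. norm (map_mat complex_of_real (A_alpha_mat \<alpha> G vs) $$ (i, j)) * w (vs ! j))
    = (\<Sum>j<length vs. (if i = j then \<alpha> * out_degree G ?u * w ?u else 0) + ?f (vs ! j))"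
  proof (rule sum.cong[OF refl])
    fix j assume j: "j \<in> {..<length vs}"
    have "map_mat complex_of_real (A_alpha_mat \<alpha> G vs) $$ (i, j)
      = complex_of_real (A_alpha_mat \<alpha> G vs $$ (i, j))"
      using A_alpha_mat_carrier[of \<alpha> G vs] i j by simp
    moreover have "A_alpha_mat \<alpha> G vs $$ (i, j) \<ge> 0"
      using i j \<alpha> by (simp add: A_alpha_mat_index)
    ultimately have "norm (map_mat complex_of_real (A_alpha_mat \<alpha> G vs) $$ (i, j))
      = A_alpha_mat \<alpha> G vs $$ (i, j)"
      by simp
    then show "norm (map_mat complex_of_real (A_alpha_mat \<alpha> G vs) $$ (i, j)) * w (vs ! j)
      = (if i = j then \<alpha> * out_degree G ?u * w ?u else 0) + ?f (vs ! j)"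
      using i j by (auto simp: A_alpha_mat_index algebra_simps)
  qed
  also have "\<dots> = \<alpha> * out_degree G ?u * w ?u + (\<Sum>j<length vs. ?f (vs ! j))"
    using i by (simp add: sum.distrib)
  also have "(\<Sum>j<length vs. ?f (vs ! j)) = (\<Sum>v\<in>verts G. ?f v)"
    by (rule sum.reindex_bij_betw[OF nth])
  also have "\<dots> = (\<Sum>v | ?u \<rightarrow> v. (1 - \<alpha>) * w v)"
    by (rule sum.mono_neutral_cong_right) auto
  finally show ?thesis by (simp add: sum_distrib_left)
qed

theorem theorem1p1:
  fixes G1 :: "('a, 'b) pre_digraph" and G2 :: "('c, 'd) pre_digraph"
    and vs1 :: "'a list" and vs2 :: "'c list"
    and n m :: nat and \<alpha> :: real
  assumes "digraph G1" and "digraph G2"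
    and "strongly_connected G1" and "strongly_connected G2"
    and "distinct vs1" and "set vs1 = verts G1"
    and "distinct vs2" and "set vs2 = verts G2"
    and "card (verts G1) = n" and "card (verts G2) = n" and "n \<ge> 4"
    and "card (arcs G1) = m" and "card (arcs G2) = m"
    and "1 / sqrt 2 \<le> \<alpha>" and "\<alpha> < 1"
    and "real (max_out_degree G1) \<ge> 2 * \<alpha> * (1 - \<alpha>) * (real m - real n + 1) + 2 * \<alpha>"
    and "max_out_degree G1 > max_out_degree G2"
  shows "A_alpha_spectral_radius \<alpha> G1 vs1 > A_alpha_spectral_radius \<alpha> G2 vs2"
proof -
  interpret G1: digraph G1 by fact
  interpret G2: digraph G2 by fact
  let ?D = "real (max_out_degree G1)"
  define K where "K = real m - real n + 1"
  have \<alpha>0: "\<alpha> > 0" using assms(14) by (smt (verit) divide_pos_pos real_sqrt_gt_zero)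
  have "(1 / sqrt 2)\<^sup>2 \<le> \<alpha>\<^sup>2" using assms(14) by (intro power_mono) auto
  then have \<alpha>2: "1 \<le> 2 * \<alpha>\<^sup>2" by (simp add: power_divide)
  have K: "(1 - \<alpha>) * K \<le> \<alpha> * ?D - 1"
  proof -
    have "2 * \<alpha> * ((1 - \<alpha>) * K) \<le> 1 * ?D - 2 * \<alpha>"
      using assms(16) by (simp add: K_def mult.assoc)
    \<comment> \<open>The lower bound on \<alpha> enters here: enlarging the coefficient of
      \<open>?D\<close> from 1 to \<open>2 * \<alpha>\<^sup>2\<close> produces the common factor
      \<open>2 * \<alpha>\<close>, which is then cancelled.\<close>
    also have "\<dots> \<le> 2 * \<alpha>\<^sup>2 * ?D - 2 * \<alpha>"
      using mult_right_mono[OF \<alpha>2, of ?D] by simp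
    also have "\<dots> = 2 * \<alpha> * (\<alpha> * ?D - 1)"
      by (simp add: power2_eq_square algebra_simps)
    finally show ?thesis using \<alpha>0 by simp
  qed
  have pos: "out_degree G2 u > 0" if "u \<in> verts G2" for u
  proof -
    \<comment> \<open>A second vertex exists since n is at least 4, so strong connectivity forces an
      arc out of \<open>u\<close>. The outdegrees are therefore admissible as positive
      weights.\<close>
    have "\<not> verts G2 \<subseteq> {u}" using assms(10,11) card_mono[of "{u}" "verts G2"] by auto
    then obtain v where "v \<in> verts G2" "u \<noteq> v" by auto
    with that show ?thesis by (intro G2.out_degree_pos[OF assms(4)]) auto
  qed
  have len: "length vs2 = n" using assms(7,8,10) distinct_card by metis
  have "A_alpha_spectral_radius \<alpha> G2 vs2 < \<alpha> * ?D"
    unfolding A_alpha_spectral_radius_def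
  proof (rule spectral_radius_less_weighted_row_sum[where w = "\<lambda>i. real (out_degree G2 (vs2 ! i))"])
    show "map_mat complex_of_real (A_alpha_mat \<alpha> G2 vs2) \<in> carrier_mat (length vs2) (length vs2)"
      using A_alpha_mat_carrier by simp
    show "length vs2 > 0" using len assms(11) by simp
    fix i assume i: "i < length vs2"
    define u where "u = vs2 ! i"
    have u: "u \<in> verts G2" using nth_mem[OF i] assms(8) by (simp add: u_def)
    show "real (out_degree G2 (vs2 ! i)) > 0" using pos u by (simp add: u_def)
    define d where "d = real (out_degree G2 u)"
    have d1: "d \<ge> 1" using pos[OF u] by (simp add: d_def)
    have "out_degree G2 u \<le> max_out_degree G2"
      unfolding max_out_degree_def using u by (intro Max_ge) auto
    \<comment> \<open>Outdegrees are integers, so the strict comparison of maximum outdegrees yields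
      a gap of a full 1; this gives the sign of the factor \<open>d - (?D - 1)\<close>
      below.\<close>
    with assms(17) have d2: "d \<le> ?D - 1" by (simp add: d_def)
    have S: "real (\<Sum>v | u \<rightarrow>\<^bsub>G2\<^esub> v. out_degree G2 v) \<le> K"
      using G2.sum_out_degree_out_neighbours[OF pos u] assms(10,13) unfolding K_def by linarith
    have "(\<Sum>j<length vs2. norm (map_mat complex_of_real (A_alpha_mat \<alpha> G2 vs2) $$ (i, j)) *
        real (out_degree G2 (vs2 ! j)))
      = \<alpha> * d * d + (1 - \<alpha>) * real (\<Sum>v | u \<rightarrow>\<^bsub>G2\<^esub> v. out_degree G2 v)"
      using G2.A_alpha_weighted_row_sum[OF assms(7,8) i, of \<alpha> "\<lambda>v. real (out_degree G2 v)"]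
        \<alpha>0 assms(15) by (simp add: u_def d_def)
    also have "\<dots> \<le> \<alpha> * d * d + (1 - \<alpha>) * K"
      using S assms(15) by (intro add_left_mono mult_left_mono) auto
    \<comment> \<open>Once \<open>(1 - \<alpha>) * K\<close> is replaced by its bound
      \<open>\<alpha> * ?D - 1\<close>, the two sides are equal.\<close>
    also have "\<dots> \<le> \<alpha> * ?D * d + (\<alpha> * ((d - 1) * (d - (?D - 1))) - (1 - \<alpha>))"
      using K by (simp add: algebra_simps)
    \<comment> \<open>The product vanishes at \<open>d = 1\<close> and at \<open>d = ?D - 1\<close>,
      so strictness comes from \<open>1 - \<alpha> > 0\<close>.\<close>
    also have "\<dots> < \<alpha> * ?D * d"
    proof -
      have "\<alpha> * ((d - 1) * (d - (?D - 1))) \<le> 0"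
        using \<alpha>0 d1 d2 by (intro mult_nonneg_nonpos) auto
      with assms(15) show ?thesis by linarith
    qed
    finally show "(\<Sum>j<length vs2. norm (map_mat complex_of_real (A_alpha_mat \<alpha> G2 vs2) $$ (i, j)) *
        real (out_degree G2 (vs2 ! j))) < \<alpha> * ?D * real (out_degree G2 (vs2 ! i))"
      by (simp add: d_def u_def)
  qed
  \<comment> \<open>Strong connectivity of \<open>G1\<close> includes that its vertex set is
    nonempty, so the maximum outdegree is attained.\<close>
  also have "\<alpha> * ?D \<le> A_alpha_spectral_radius \<alpha> G1 vs1"
    using G1.A_alpha_spectral_radius_ge[OF assms(6)] \<alpha>0 assms(3,15)
    by (simp add: strongly_connected_def)
  finally show ?thesis .
qed

end
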